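(* Let $\Phi$ and $\phi$ be the distribution function and the density function of a standard normal random variable, respectively. Let $P$ be a distribution function on $(0,1)$ with density $p$, and suppose that $p$ is bounded almost everywhere, i.e. there is a constant $M>0$ such that $p(x)\le M$ for Lebesgue-almost every $x\in(0,1)$. Let $S$ be the distribution on $\mathbb{R}$ with density $$s(y)=\phi(y)\,p[\Phi(y)],\qquad y\in\mathbb{R}.$$ Then $S$ is not infinitely divisible unless it is normal.
   Context: "Normal" means a normal distribution $N(\mu,\sigma^2)$ with some mean $\mu\in\mathbb{R}$ and some variance $\sigma^2>0$. A probability distribution $S$ on $\mathbb{R}$ is infinitely divisible if for every integer $n\ge 1$ there is a probability distribution on $\mathbb{R}$ whose $n$-fold convolution with itself equals $S$. *)

theory Defs
  imports "HOL-Probability.Probability"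
begin

text \<open>
  \<open>f\<close> is a density on \<open>A\<close> of the probability distribution with distribution function \<open>F\<close>.
  The distribution is concentrated on \<open>A\<close>, and the values of \<open>f\<close> outside \<open>A\<close> play no role.
\<close>

definition distribution_function_with_density_on ::
    "real set \<Rightarrow> (real \<Rightarrow> real) \<Rightarrow> (real \<Rightarrow> real) \<Rightarrow> bool" where
  "distribution_function_with_density_on A F f \<longleftrightarrow>
     f \<in> borel_measurable (restrict_space borel A) \<and> (\<forall>x\<in>A. 0 \<le> f x) \<and>
     (\<exists>\<mu>. real_distribution \<mu> \<and> F = cdf \<mu> \<and>
          \<mu> = density lborel (\<lambda>x. ennreal (f x) * indicator A x))"

definition normal_distribution :: "real measure \<Rightarrow> bool" where
  "normal_distribution S \<longleftrightarrow>
     (\<exists>\<mu> \<sigma>. 0 < \<sigma> \<and> S = density lborel (\<lambda>x. ennreal (normal_density \<mu> \<sigma> x)))"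

text \<open>The empty convolution is the point mass at \<open>0\<close>, the neutral element of convolution.\<close>

primrec convolution_power :: "nat \<Rightarrow> real measure \<Rightarrow> real measure" where
  "convolution_power 0 Q = return borel 0"
| "convolution_power (Suc n) Q = convolution Q (convolution_power n Q)"

definition infinitely_divisible :: "real measure \<Rightarrow> bool" where
  "infinitely_divisible S \<longleftrightarrow>
     real_distribution S \<and> (\<forall>n\<ge>1. \<exists>Q. real_distribution Q \<and> convolution_power n Q = S)"

end

theory Submission
  imports Defs "HOL-Complex_Analysis.Complex_Analysis"
begin

text \<open>
  Since \<open>p\<close> is bounded, the density of \<open>S\<close> is at most \<open>M \<phi>\<close> almost everywhere, so the moment generating
  function \<open>f\<close> of \<open>S\<close> is entire and \<open>\<bar>f z\<bar> \<le> M exp ((Re z)\<^sup>2 / 2)\<close>. If \<open>S\<close> is infinitely divisible, \<open>f\<close> is an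
  \<open>n\<close>-th power of an entire function for every \<open>n \<ge> 1\<close>, so it has no zeros and \<open>f = exp g\<close> with \<open>g\<close> entire.
  The real part of \<open>g\<close> grows at most quadratically, hence \<open>g\<close> is a polynomial of degree at most 2, and \<open>S\<close>
  is normal or a point mass.
\<close>

subsection \<open>Entire functions\<close>

text \<open>Borel-Caratheodory on the disc of radius 2|z| turns the one-sided bound on the real part
  into a bound on |g z - g 0| of the same order; Liouville's theorem for polynomial growth then
  applies.\<close>

lemma Re_le_imp_polynomial:
  fixes g :: "complex \<Rightarrow> complex"
  assumes holo: "g holomorphic_on UNIV" and B: "0 \<le> B"
    and Re_le: "\<And>z. Re (g z) \<le> A + B * norm z ^ n"
  shows "g z = (\<Sum>k\<le>n. (deriv ^^ k) g 0 / fact k * z ^ k)"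
proof -
  \<comment> \<open>The summand |g 0| pays for subtracting g 0 below, and the 1 makes the later
    inequalities strict.\<close>
  define A' where "A' = \<bar>A\<bar> + norm (g 0) + 1"
  have A': "A' > 0"
    by (auto simp: A'_def intro: add_nonneg_pos)
  have bound: "norm (g z - g 0) \<le> 2 * (A' + B * (2 * norm z) ^ n)" if "z \<noteq> 0" for z
  proof -
    define K where "K = A' + B * (2 * norm z) ^ n"
    \<comment> \<open>Rescaling by 2|z| moves the point z to \<open>1/2 * sgn z\<close>, well inside
      the unit disc.\<close>
    define G where "G = (\<lambda>w. g (of_real (2 * norm z) * w) - g 0)"
    have K: "K > 0"
      using A' B by (auto simp: K_def intro!: add_pos_nonneg)
    have Re_G: "Re (G w) < K" if "norm w < 1" for w
    proof -
      have "B * norm (of_real (2 * norm z) * w) ^ n \<le> B * (2 * norm z) ^ n"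
        using that B by (intro mult_left_mono power_mono) (auto simp: norm_mult mult_left_le)
      moreover have "- Re (g 0) \<le> norm (g 0)"
        using abs_Re_le_cmod[of "g 0"] by linarith
      ultimately show ?thesis
        using Re_le[of "of_real (2 * norm z) * w"] by (simp add: G_def K_def A'_def)
    qed
    have nz: "2 * of_real K - G w \<noteq> 0" if "norm w < 1" for w
      using Re_G[OF that] K by (auto simp: complex_eq_iff)
    \<comment> \<open>A point whose real part is below K lies nearer to 0 than to 2K.\<close>
    have less: "norm (G w) < norm (2 * of_real K - G w)" if "norm w < 1" for w
    proof -
      have "(Re (G w))\<^sup>2 < (2 * K - Re (G w))\<^sup>2"
        using Re_G[OF that] K
        by (auto simp: power2_eq_square algebra_simps)
      then show ?thesis
        by (simp add: cmod_def)
    qed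
    \<comment> \<open>Borel--Caratheodory: this quotient maps the unit disc into itself.\<close>
    define h where "h = (\<lambda>w. G w / (2 * of_real K - G w))"
    have holG: "G holomorphic_on ball 0 1"
      unfolding G_def
      by (intro holomorphic_intros holomorphic_on_compose_gen[OF _ holo, unfolded o_def]) auto
    \<comment> \<open>Schwarz's lemma at a point of modulus 1/2 gives |G| <= |2K - G| / 2 <= K + |G|
      / 2 there, hence |G| <= 2K.\<close>
    have "norm (h (1/2 * sgn z)) \<le> norm (1/2 * sgn z)"
    proof (rule Schwarz_Lemma(1))
      show "h holomorphic_on ball 0 1"
        unfolding h_def using nz by (intro holomorphic_intros holG) auto
      show "h 0 = 0"
        by (simp add: h_def G_def)
      show "norm (h w) < 1" if "norm w < 1" for w
        using less[OF that] nz[OF that] by (simp add: h_def norm_divide)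
      show "norm (1/2 * sgn z) < 1"
        using that by (simp add: norm_mult norm_sgn)
    qed
    moreover have Gz: "G (1/2 * sgn z) = g z - g 0"
      using that by (simp add: G_def sgn_div_norm scaleR_conv_of_real mult.assoc[symmetric])
    moreover have lt1: "norm (1/2 * sgn z) < 1" and eq: "norm (1/2 * sgn z) = 1/2"
      using that by (auto simp: norm_mult norm_sgn)
    ultimately have "norm (G (1/2 * sgn z)) / norm (2 * of_real K - G (1/2 * sgn z)) \<le> 1/2"
      by (simp add: h_def norm_divide)
    with nz[OF lt1] have "norm (G (1/2 * sgn z)) \<le> 1/2 * norm (2 * of_real K - G (1/2 * sgn z))"
      by (subst (asm) pos_divide_le_eq) auto
    then have "norm (g z - g 0) \<le> 1/2 * norm (2 * of_real K - (g z - g 0))"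
      unfolding Gz .
    also have "\<dots> \<le> 1/2 * (2 * K + norm (g z - g 0))"
      using norm_triangle_ineq4[of "2 * of_real K" "g z - g 0"] K by (simp add: norm_mult)
    finally show ?thesis
      by (simp add: K_def)
  qed
  \<comment> \<open>For |w| >= 1 the constant terms are absorbed into |w|^n.\<close>
  have "norm (g w) \<le> (norm (g 0) + 2 * (A' + B * 2 ^ n)) * norm w ^ n" if w: "1 \<le> norm w" for w
  proof -
    have "norm (g w) \<le> (norm (g 0) + 2 * A') * 1 + 2 * B * 2 ^ n * norm w ^ n"
    proof -
      have "norm (g w) \<le> norm (g 0) + norm (g w - g 0)"
        by (rule norm_triangle_sub)
      also have "norm (g w - g 0) \<le> 2 * (A' + B * (2 * norm w) ^ n)"
        using w by (intro bound) auto
      finally show ?thesis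
        by (simp add: power_mult_distrib algebra_simps)
    qed
    also have "\<dots> \<le> (norm (g 0) + 2 * A') * norm w ^ n + 2 * B * 2 ^ n * norm w ^ n"
      using w A' by (intro add_right_mono mult_left_mono) auto
    finally show ?thesis
      by (simp add: algebra_simps)
  qed
  then show ?thesis
    by (rule Liouville_polynomial[OF holo])
qed

text \<open>The order of a zero of \<open>f\<close> would be divisible by every positive integer.\<close>

lemma holomorphic_all_roots_nonzero:
  fixes f :: "complex \<Rightarrow> complex"
  assumes holf: "f holomorphic_on UNIV" and nz: "f a \<noteq> 0"
    and root: "\<And>n. 1 \<le> n \<Longrightarrow> \<exists>h. h holomorphic_on UNIV \<and> (\<forall>z. f z = h z ^ n)"
  shows "f z \<noteq> 0"
proof -
  \<comment> \<open>Orders of zeros can be used only for functions that do not vanish identically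
    near z; being nonzero at a ensures this by the identity theorem.\<close>
  have freq: "\<exists>\<^sub>F w in at z. u w \<noteq> 0" if "u holomorphic_on UNIV" "u a \<noteq> 0" for u :: "complex \<Rightarrow> complex"
  proof (rule ccontr)
    assume "\<not> ?thesis"
    then have "\<forall>\<^sub>F w in at z. u w = 0"
      by (simp add: not_frequently)
    then obtain e where e: "e > 0" "\<And>w. w \<noteq> z \<Longrightarrow> dist w z < e \<Longrightarrow> u w = 0"
      unfolding eventually_at by auto
    have "u a = 0"
    proof (rule analytic_continuation[OF that(1)])
      show "z islimpt (ball z e - {z})"
        using e(1) by (simp add: islimpt_punctured[symmetric] interior_limit_point)
    qed (use e in \<open>auto simp: dist_commute\<close>)
    with that show False by simp
  qed
  \<comment> \<open>This n exceeds the absolute value of the order, so the order can be a multiple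
    of n only if it is 0.\<close>
  define n where "n = nat \<bar>zorder f z\<bar> + 1"
  obtain h where h: "h holomorphic_on UNIV" and fh: "\<And>z. f z = h z ^ n"
    using root[of n] by (auto simp: n_def)
  have "h a \<noteq> 0"
    using fh[of a] nz by (auto simp: n_def)
  have "zorder f z = n * zorder h z"
  proof -
    have "zorder (\<lambda>z. h z ^ n) z = n * zorder h z"
      using h freq[OF h \<open>h a \<noteq> 0\<close>]
      by (intro zorder_power analytic_on_imp_meromorphic_on) (auto simp: analytic_on_holomorphic)
    moreover have "(\<lambda>z. h z ^ n) = f"
      using fh by auto
    ultimately show ?thesis by simp
  qed
  then have "int n dvd zorder f z"
    by simp
  moreover have "\<bar>zorder f z\<bar> < int n"
    by (simp add: n_def)
  ultimately have "zorder f z = 0"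
    using dvd_imp_le_int[of "zorder f z" "int n"] by fastforce
  moreover have "f analytic_on {z}"
    using holf by (auto simp: analytic_on_holomorphic)
  ultimately show ?thesis
    using freq[OF holf nz] zorder_eq_0_iff by blast
qed

text \<open>The sine of the quadratic phase vanishes for all t. Its derivative at 0 is
  \<open>Im a\<close>; once that is 0, a nonzero \<open>Im b\<close> would let the phase reach plus
  or minus pi/2.\<close>

lemma Im_eq_0_if_exp_quadratic_real:
  assumes "\<And>t::real. exp (a * of_real t + b * of_real t ^ 2) \<in> \<real>"
  shows "Im a = 0" "Im b = 0"
proof -
  have sin0: "sin (Im a * t + Im b * t\<^sup>2) = 0" for t
  proof -
    have "Im (exp (a * of_real t + b * of_real t ^ 2)) = 0"
      using assms[of t] by (simp add: complex_is_Real_iff)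
    then show ?thesis
      by (simp add: Im_exp flip: of_real_power)
  qed
  have "((\<lambda>t. sin (Im a * t + Im b * t\<^sup>2)) has_real_derivative Im a) (at 0)"
    by (auto intro!: derivative_eq_intros)
  moreover have "((\<lambda>t::real. sin (Im a * t + Im b * t\<^sup>2)) has_real_derivative 0) (at 0)"
    by (simp add: sin0)
  ultimately show "Im a = 0"
    by (rule DERIV_unique)
  show "Im b = 0"
  proof (rule ccontr)
    assume nz: "Im b \<noteq> 0"
    have "Im b * (sqrt (pi / (2 * \<bar>Im b\<bar>)))\<^sup>2 = sgn (Im b) * (pi / 2)"
      using nz by (simp add: sgn_if)
    with sin0[of "sqrt (pi / (2 * \<bar>Im b\<bar>))"] \<open>Im a = 0\<close> nz show False
      by (auto simp: sgn_if split: if_splits)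
  qed
qed

subsection \<open>Moment generating functions\<close>

text \<open>A complex argument joins the real moment generating function (real axis) and the
  characteristic function (imaginary axis) in one function, so that analytic continuation can pass
  between them.\<close>

definition complex_mgf :: "real measure \<Rightarrow> complex \<Rightarrow> complex" where
  "complex_mgf M z = (\<integral>x. exp (z * of_real x) \<partial>M)"

lemma complex_mgf_ii_eq_char: "complex_mgf M (\<i> * of_real t) = char M t"
  by (simp add: complex_mgf_def char_def mult.assoc)

lemma complex_mgf_of_real: "complex_mgf M (of_real t) = of_real (\<integral>x. exp (t * x) \<partial>M)"
  by (simp add: complex_mgf_def exp_of_real flip: of_real_mult)

lemma norm_complex_mgf_le: "norm (complex_mgf M z) \<le> (\<integral>x. exp (Re z * x) \<partial>M)"
  using integral_norm_bound[of M "\<lambda>x. exp (z * of_real x)"] by (simp add: complex_mgf_def)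

lemma sum_power_div_fact_le_exp:
  fixes u :: real
  assumes "0 \<le> u"
  shows "(\<Sum>k<n. u ^ k / fact k) \<le> exp u"
proof -
  have "(\<lambda>k. u ^ k / fact k) sums exp u"
    using exp_converges[of u] by (simp add: divide_inverse mult.commute scaleR_conv_of_real)
  then show ?thesis
    using assms by (intro sum_le_suminf[of "\<lambda>k. u ^ k / fact k" "{..<n}", THEN order_trans])
      (auto simp: sums_iff)
qed

context real_distribution
begin

context
  assumes integrable_exp: "\<And>t. integrable M (\<lambda>x. exp (t * x))"
begin

lemma integrable_exp_abs: "integrable M (\<lambda>x. exp (t * \<bar>x\<bar>))"
proof (rule Bochner_Integration.integrable_bound)
  show "integrable M (\<lambda>x. exp (t * x) + exp (- t * x))"
    by (intro Bochner_Integration.integrable_add integrable_exp)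
  have "exp (t * \<bar>x\<bar>) \<le> exp (t * x) + exp (- t * x)" for x
    by (cases "x < 0") auto
  then show "AE x in M. norm (exp (t * \<bar>x\<bar>)) \<le> norm (exp (t * x) + exp (- t * x))"
    by (intro AE_I2) (simp add: abs_of_pos add_pos_pos)
qed simp

text \<open>The exponential series is integrated term by term: the partial sums of the norms stay
  below exp (|z| |x|), which is integrable.\<close>

lemma complex_mgf_sums:
  "(\<lambda>k. (\<integral>x. of_real (x ^ k / fact k) \<partial>M) * z ^ k) sums complex_mgf M z"
proof -
  define f :: "nat \<Rightarrow> real \<Rightarrow> complex" where "f = (\<lambda>k x. of_real (x ^ k / fact k) * z ^ k)"
  have [measurable]: "f k \<in> borel_measurable M" for k
    unfolding f_def by measurable
  have norm_f: "norm (f k x) = (norm z * \<bar>x\<bar>) ^ k / fact k" for k x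
    by (simp add: f_def norm_mult norm_divide norm_power power_mult_distrib)
  have partial: "(\<Sum>k<n. norm (f k x)) \<le> exp (norm z * \<bar>x\<bar>)" for n x
    unfolding norm_f by (rule sum_power_div_fact_le_exp) simp
  have integrable_f: "integrable M (f k)" for k
  proof (rule Bochner_Integration.integrable_bound[OF integrable_exp_abs[of "norm z"]])
    have "norm (f k x) \<le> exp (norm z * \<bar>x\<bar>)" for x
      using partial[of x "Suc k"] sum_nonneg[of "{..<k}" "\<lambda>k. norm (f k x)"] by simp
    then show "AE x in M. norm (f k x) \<le> norm (exp (norm z * \<bar>x\<bar>))"
      by simp
  qed simp
  have sums: "(\<lambda>k. f k x) sums exp (z * of_real x)" for x
  proof -
    have "(z * of_real x) ^ k /\<^sub>R fact k = f k x" for k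
      by (simp add: f_def scaleR_conv_of_real power_mult_distrib divide_inverse)
    then show ?thesis
      using exp_converges[of "z * of_real x"] by simp
  qed
  have "(\<lambda>k. integral\<^sup>L M (f k)) sums (\<integral>x. (\<Sum>k. f k x) \<partial>M)"
  proof (rule sums_integral[OF integrable_f])
    show "AE x in M. summable (\<lambda>k. norm (f k x))"
      by (auto intro!: summableI_nonneg_bounded[OF _ partial])
    show "summable (\<lambda>k. \<integral>x. norm (f k x) \<partial>M)"
    proof (rule summableI_nonneg_bounded)
      fix n
      have "(\<Sum>k<n. \<integral>x. norm (f k x) \<partial>M) = (\<integral>x. (\<Sum>k<n. norm (f k x)) \<partial>M)"
        by (intro Bochner_Integration.integral_sum[symmetric] integrable_norm integrable_f)
      also have "\<dots> \<le> (\<integral>x. exp (norm z * \<bar>x\<bar>) \<partial>M)"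
        by (intro integral_mono integrable_exp_abs partial Bochner_Integration.integrable_sum
              integrable_norm integrable_f)
      finally show "(\<Sum>k<n. \<integral>x. norm (f k x) \<partial>M) \<le> (\<integral>x. exp (norm z * \<bar>x\<bar>) \<partial>M)" .
    qed simp
  qed
  also have "(\<integral>x. (\<Sum>k. f k x) \<partial>M) = complex_mgf M z"
    using sums by (simp add: complex_mgf_def sums_iff)
  finally show ?thesis
    by (simp add: f_def)
qed

lemma complex_mgf_holomorphic: "complex_mgf M holomorphic_on UNIV"
proof -
  have "complex_mgf M holomorphic_on ball 0 r" for r
    by (rule power_series_holomorphic, unfold diff_0_right) (rule complex_mgf_sums)
  then have "complex_mgf M field_differentiable at z" for z
    by (rule holomorphic_on_imp_differentiable_at[of _ "ball 0 (norm z + 1)"]) auto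
  then show ?thesis
    by (simp add: holomorphic_on_def field_differentiable_at_within)
qed

end

end

section \<open>Convolution powers and their moment generating functions\<close>

lemma convolution_power_finite_borel:
  assumes "real_distribution Q"
  shows "finite_measure (convolution_power n Q) \<and> sets (convolution_power n Q) = sets borel"
proof -
  interpret Q: real_distribution Q by fact
  show ?thesis
  proof (induction n)
    case 0
    show ?case
      by (simp add: prob_space_return prob_space.finite_measure)
  next
    case (Suc n)
    then show ?case
      using convolution_finite[OF Q.finite_measure_axioms] by simp
  qed
qed

text \<open>In \<open>ennreal\<close> the iterated integral factors before anything is known about
  integrability under Q; finiteness for Q is later read off from this identity.\<close>

lemma nn_integral_exp_convolution_power:
  assumes "real_distribution Q"
  shows "(\<integral>\<^sup>+x. ennreal (exp (t * x)) \<partial>convolution_power n Q) = (\<integral>\<^sup>+x. ennreal (exp (t * x)) \<partial>Q) ^ n"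
proof -
  interpret Q: real_distribution Q by fact
  show ?thesis
  proof (induction n)
    case 0
    show ?case
      by (simp add: nn_integral_return)
  next
    case (Suc n)
    have [measurable_cong]: "sets (convolution_power n Q) = sets borel"
      using convolution_power_finite_borel[OF assms] by auto
    have "(\<integral>\<^sup>+x. ennreal (exp (t * x)) \<partial>convolution_power (Suc n) Q) =
        (\<integral>\<^sup>+x. \<integral>\<^sup>+y. ennreal (exp (t * x)) * ennreal (exp (t * y)) \<partial>convolution_power n Q \<partial>Q)"
      using convolution_power_finite_borel[OF assms]
      by (simp add: nn_integral_convolution Q.finite_measure_axioms distrib_left exp_add ennreal_mult)
    also have "\<dots> = (\<integral>\<^sup>+x. ennreal (exp (t * x)) \<partial>Q) ^ Suc n"
      by (simp add: nn_integral_cmult nn_integral_multc Suc.IH)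
    finally show ?case .
  qed
qed

lemma complex_mgf_convolution_power:
  assumes Q: "real_distribution Q" and S: "real_distribution (convolution_power n Q)" and n: "1 \<le> n"
    and integrable_exp: "\<And>t. integrable (convolution_power n Q) (\<lambda>x. exp (t * x))"
  shows "complex_mgf Q holomorphic_on UNIV"
    and "complex_mgf (convolution_power n Q) z = complex_mgf Q z ^ n"
proof -
  interpret Q: real_distribution Q by fact
  interpret S: real_distribution "convolution_power n Q" by fact
  have nn_S: "(\<integral>\<^sup>+x. ennreal (exp (t * x)) \<partial>convolution_power n Q) =
      ennreal (\<integral>x. exp (t * x) \<partial>convolution_power n Q)" for t
    by (rule nn_integral_eq_integral[OF integrable_exp]) simp
  have integrable_Q: "integrable Q (\<lambda>x. exp (t * x))" for t
  proof (rule integrableI_bounded)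
    \<comment> \<open>A finite n-th power with n >= 1 has a finite base, so the convolution root
      inherits all exponential moments.\<close>
    have "(\<integral>\<^sup>+x. ennreal (exp (t * x)) \<partial>Q) ^ n < \<infinity>"
      by (simp flip: nn_integral_exp_convolution_power[OF Q] add: nn_S)
    then show "(\<integral>\<^sup>+x. ennreal (norm (exp (t * x))) \<partial>Q) < \<infinity>"
      using n by (simp add: power_less_top_ennreal)
  qed simp
  show holQ: "complex_mgf Q holomorphic_on UNIV"
    by (rule Q.complex_mgf_holomorphic[OF integrable_Q])
  have real_eq: "complex_mgf (convolution_power n Q) (of_real t) = complex_mgf Q (of_real t) ^ n" for t
  proof -
    have "ennreal (\<integral>x. exp (t * x) \<partial>convolution_power n Q) = ennreal ((\<integral>x. exp (t * x) \<partial>Q) ^ n)"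
      using nn_integral_exp_convolution_power[OF Q, where t = t and n = n]
      by (simp add: nn_S nn_integral_eq_integral[OF integrable_Q] ennreal_power)
    then have "(\<integral>x. exp (t * x) \<partial>convolution_power n Q) = (\<integral>x. exp (t * x) \<partial>Q) ^ n"
      by (subst (asm) ennreal_inj) auto
    then show ?thesis
      by (simp add: complex_mgf_of_real)
  qed
  have "complex_mgf (convolution_power n Q) z - complex_mgf Q z ^ n = 0"
  \<comment> \<open>Both sides are entire and agree on the real axis, which accumulates at
    0.\<close>
  proof (rule analytic_continuation[where f = "\<lambda>z. complex_mgf (convolution_power n Q) z - complex_mgf Q z ^ n"
        and S = UNIV and U = "\<real>" and \<xi> = 0])
    show "(\<lambda>z. complex_mgf (convolution_power n Q) z - complex_mgf Q z ^ n) holomorphic_on UNIV"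
      by (intro holomorphic_intros holQ S.complex_mgf_holomorphic integrable_exp)
    show "0 islimpt (\<real> :: complex set)"
      unfolding islimpt_approachable
    proof safe
      fix e :: real assume "0 < e"
      then show "\<exists>x'\<in>\<real>. x' \<noteq> (0::complex) \<and> dist x' 0 < e"
        by (intro bexI[of _ "of_real (e / 2)"]) auto
    qed
  qed (auto elim!: Reals_cases simp: real_eq)
  then show "complex_mgf (convolution_power n Q) z = complex_mgf Q z ^ n"
    by simp
qed

section \<open>Infinitely divisible laws with a Gaussian bound on the moment generating
  function\<close>

lemma infinitely_divisible_complex_mgf_nonzero:
  assumes S: "infinitely_divisible S" and integrable_exp: "\<And>t. integrable S (\<lambda>x. exp (t * x))"
  shows "complex_mgf S z \<noteq> 0"
proof -
  interpret S: real_distribution S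
    using S by (simp add: infinitely_divisible_def)
  show ?thesis
  proof (rule holomorphic_all_roots_nonzero[where f = "complex_mgf S" and a = 0])
    show "complex_mgf S holomorphic_on UNIV"
      by (rule S.complex_mgf_holomorphic[OF integrable_exp])
    show "complex_mgf S 0 \<noteq> 0"
      using S.char_zero complex_mgf_ii_eq_char[of S 0] by simp
  next
    fix n :: nat assume n: "1 \<le> n"
    then obtain Q where "real_distribution Q" "convolution_power n Q = S"
      using S by (auto simp: infinitely_divisible_def)
    then show "\<exists>h. h holomorphic_on UNIV \<and> (\<forall>z. complex_mgf S z = h z ^ n)"
      using complex_mgf_convolution_power[of Q n] n integrable_exp S.real_distribution_axioms by metis
  qed
qed

lemma infinitely_divisible_gaussian_bound_char:
  assumes S: "infinitely_divisible S" and integrable_exp: "\<And>t. integrable S (\<lambda>x. exp (t * x))"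
    and le: "\<And>t. (\<integral>x. exp (t * x) \<partial>S) \<le> C * exp (B * t\<^sup>2)" and B: "0 \<le> B"
  obtains \<mu> c where "0 \<le> c" "\<And>t. char S t = exp (of_real (- c * t\<^sup>2) + \<i> * of_real (\<mu> * t))"
proof -
  interpret S: real_distribution S
    using S by (simp add: infinitely_divisible_def)
  define f where "f = complex_mgf S"
  have f0: "f 0 = 1"
    using S.char_zero complex_mgf_ii_eq_char[of S 0] by (simp add: f_def)
  have "f holomorphic_on UNIV"
    unfolding f_def by (rule S.complex_mgf_holomorphic[OF integrable_exp])
  moreover have "f z \<noteq> 0" for z
    unfolding f_def by (rule infinitely_divisible_complex_mgf_nonzero[OF S integrable_exp])
  \<comment> \<open>The plane is contractible, so a zero-free entire function has an entire
    logarithm.\<close>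
  ultimately obtain g where g: "g holomorphic_on UNIV" and fg: "\<And>z. f z = exp (g z)"
    using contractible_imp_holomorphic_log[of f UNIV] by auto
  have norm_f: "norm (f z) \<le> C * exp (B * (Re z)\<^sup>2)" for z
    using norm_complex_mgf_le[of S z] le[of "Re z"] by (simp add: f_def)
  have C: "C > 0"
    using norm_f[of 0] f0 by simp
  have Re_g: "Re (g z) \<le> ln C + B * norm z ^ 2" for z
  proof -
    have "exp (Re (g z)) \<le> exp (ln C + B * (Re z)\<^sup>2)"
      using norm_f[of z] C by (simp add: fg exp_add)
    moreover have "(Re z)\<^sup>2 \<le> norm z ^ 2"
      by (rule abs_le_square_iff[THEN iffD1]) (simp add: abs_Re_le_cmod)
    ultimately show ?thesis
      using B by (smt (verit) exp_le_cancel_iff mult_left_mono)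
  qed
  define a where "a = deriv g 0"
  define b where "b = deriv (deriv g) 0 / 2"
  have "g z = g 0 + a * z + b * z ^ 2" for z
    using Re_le_imp_polynomial[OF g B Re_g, of z]
    by (simp add: a_def b_def numeral_2_eq_2)
  \<comment> \<open>The logarithm is fixed only up to multiples of 2 pi i, so \<open>g 0\<close>
    itself need not be 0.\<close>
  moreover have "exp (g 0) = 1"
    using fg[of 0] f0 by simp
  ultimately have f: "f z = exp (a * z + b * z ^ 2)" for z
    by (metis fg add.assoc exp_add mult_1)
  have "exp (a * of_real t + b * of_real t ^ 2) \<in> \<real>" for t
    using f[of "of_real t"] by (simp add: f_def complex_mgf_of_real flip: f)
  then have "Im a = 0" "Im b = 0"
    by (auto intro: Im_eq_0_if_exp_quadratic_real)
  then have ab: "a = of_real (Re a)" "b = of_real (Re b)"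
    by (auto simp: complex_eq_iff)
  have char: "char S t = exp (of_real (- Re b * t\<^sup>2) + \<i> * of_real (Re a * t))" for t
  proof -
    \<comment> \<open>On the imaginary axis the square contributes a minus sign, so
      \<open>Re b\<close> becomes the Gaussian decay rate c.\<close>
    have "char S t = exp (a * (\<i> * of_real t) + b * (\<i> * of_real t) ^ 2)"
      using f[of "\<i> * of_real t"] by (simp add: f_def complex_mgf_ii_eq_char)
    then show ?thesis
      by (subst (asm) ab(1), subst (asm) ab(2)) (simp add: power_mult_distrib mult_ac)
  qed
  \<comment> \<open>The modulus of the characteristic function at 1 is exp (- Re b), and it is at
    most 1.\<close>
  have "0 \<le> Re b"
    using S.cmod_char_le_1[of 1] by (simp add: char)
  then show thesis
    using that char by blast
qed

text \<open>The law is the image of the standard normal one under x -> \<mu> + \<sigma> x, which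
  reduces the claim to the known characteristic function.\<close>

lemma char_normal_density:
  assumes "0 < \<sigma>"
  shows "char (density lborel (\<lambda>x. ennreal (normal_density \<mu> \<sigma> x))) t =
    exp (of_real (- (\<sigma>\<^sup>2 / 2) * t\<^sup>2) + \<i> * of_real (\<mu> * t))"
proof -
  interpret N: real_distribution std_normal_distribution
    by (rule real_dist_normal_dist)
  have "distributed std_normal_distribution lborel (\<lambda>x. x) std_normal_density"
    by (simp add: distributed_def distr_id2)
  from N.normal_density_affine[OF this, of \<sigma> \<mu>]
  have "density lborel (\<lambda>x. ennreal (normal_density \<mu> \<sigma> x)) =
      distr std_normal_distribution lborel (\<lambda>x. \<mu> + \<sigma> * x)"
    using assms by (simp add: distributed_def)
  then have "char (density lborel (\<lambda>x. ennreal (normal_density \<mu> \<sigma> x))) t =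
      (\<integral>x. iexp (t * (\<mu> + \<sigma> * x)) \<partial>std_normal_distribution)"
    unfolding char_def by (simp add: integral_distr)
  also have "\<dots> = iexp (\<mu> * t) * char std_normal_distribution (t * \<sigma>)"
    unfolding char_def by (simp add: distrib_left exp_add mult_ac flip: integral_mult_right_zero)
  also have "\<dots> = exp (of_real (- (\<sigma>\<^sup>2 / 2) * t\<^sup>2) + \<i> * of_real (\<mu> * t))"
    by (simp add: char_std_normal_distribution mult_exp_exp power_mult_distrib mult_ac flip: exp_of_real)
  finally show ?thesis .
qed

lemma char_return: "char (return borel \<mu>) t = exp (\<i> * of_real (\<mu> * t))"
  by (simp add: char_def integral_return mult.commute)

text \<open>The characteristic function determines the law. Point masses are infinitely divisible
  and admit Gaussian bounds too, so the degenerate case c = 0 has to remain in the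
  conclusion.\<close>

theorem infinitely_divisible_gaussian_bound_normal:
  assumes S: "infinitely_divisible S" and integrable_exp: "\<And>t. integrable S (\<lambda>x. exp (t * x))"
    and le: "\<And>t. (\<integral>x. exp (t * x) \<partial>S) \<le> C * exp (B * t\<^sup>2)" and B: "0 \<le> B"
  shows "normal_distribution S \<or> (\<exists>\<mu>. S = return borel \<mu>)"
proof -
  have S': "real_distribution S"
    using S by (simp add: infinitely_divisible_def)
  obtain \<mu> c where c: "0 \<le> c"
    and char: "\<And>t. char S t = exp (of_real (- c * t\<^sup>2) + \<i> * of_real (\<mu> * t))"
    using infinitely_divisible_gaussian_bound_char[OF assms] by blast
  show ?thesis
  proof (cases "c = 0")
    case True
    have "S = return borel \<mu>"
      using S' True
      by (intro Levy_uniqueness)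
        (auto simp: char char_return fun_eq_iff real_distribution_def real_distribution_axioms_def prob_space_return)
    then show ?thesis by blast
  next
    case False
    define \<sigma> where "\<sigma> = sqrt (2 * c)"
    have \<sigma>: "0 < \<sigma>" "\<sigma>\<^sup>2 / 2 = c"
      using c False by (auto simp: \<sigma>_def)
    have "S = density lborel (\<lambda>x. ennreal (normal_density \<mu> \<sigma> x))"
    proof (rule Levy_uniqueness[OF S'])
      show "real_distribution (density lborel (\<lambda>x. ennreal (normal_density \<mu> \<sigma> x)))"
        using prob_space_normal_density[OF \<sigma>(1)]
        by (simp add: real_distribution_def real_distribution_axioms_def)
      show "char S = char (density lborel (\<lambda>x. ennreal (normal_density \<mu> \<sigma> x)))"
        by (simp add: fun_eq_iff char char_normal_density[OF \<sigma>(1)] \<sigma>(2))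
    qed
    then show ?thesis
      using \<sigma>(1) by (auto simp: normal_distribution_def)
  qed
qed

subsection \<open>Distributions dominated by the standard normal one\<close>

text \<open>Completing the square leaves the normal density with mean t and variance 1.\<close>

lemma nn_integral_std_normal_exp:
  "(\<integral>\<^sup>+x. ennreal (std_normal_density x * exp (t * x)) \<partial>lborel) = ennreal (exp (t\<^sup>2 / 2))"
proof -
  have "std_normal_density x * exp (t * x) = exp (t\<^sup>2 / 2) * normal_density t 1 x" for x
    by (simp add: normal_density_def power2_eq_square field_simps flip: exp_add)
  moreover have "(\<integral>\<^sup>+x. ennreal (normal_density t 1 x) \<partial>lborel) = 1"
    by (subst nn_integral_eq_integral) auto
  ultimately show ?thesis
    by (simp add: ennreal_mult nn_integral_cmult)
qed

section \<open>The standard normal distribution function and null sets\<close>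

lemma cdf_std_normal_distribution_diff:
  assumes "a \<le> b"
  shows "cdf std_normal_distribution b - cdf std_normal_distribution a = integral {a..b} std_normal_density"
proof -
  interpret N: real_distribution std_normal_distribution
    by (rule real_dist_normal_dist)
  have int: "set_integrable lborel {a<..b} std_normal_density"
    unfolding set_integrable_def by (intro integrable_mult_indicator) auto
  have "ennreal (measure std_normal_distribution {a<..b}) =
      (\<integral>\<^sup>+x. ennreal (indicator {a<..b} x *\<^sub>R std_normal_density x) \<partial>lborel)"
    by (auto simp: N.emeasure_eq_measure[symmetric] emeasure_density intro!: nn_integral_cong split: split_indicator)
  also have "\<dots> = ennreal (LBINT x:{a<..b}. std_normal_density x)"
    using int unfolding set_integrable_def set_lebesgue_integral_def
    by (intro nn_integral_eq_integral) auto
  finally have "measure std_normal_distribution {a<..b} = (LBINT x:{a<..b}. std_normal_density x)"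
    by (subst (asm) ennreal_inj) (auto simp: set_lebesgue_integral_def)
  also have "\<dots> = integral {a<..b} std_normal_density"
    by (rule set_borel_integral_eq_integral(2)[OF int])
  \<comment> \<open>Adding the endpoint a changes nothing and yields the closed-interval form to
    which the fundamental theorem of calculus applies.\<close>
  also have "\<dots> = integral {a..b} std_normal_density"
    by (rule integral_subset_negligible) (auto intro: negligible_subset[of "{a}"])
  finally show ?thesis
    using assms N.finite_borel_measure_M finite_borel_measure.cdf_diff_eq[of std_normal_distribution a b]
    by (cases "a = b") auto
qed

lemma continuous_on_normal_density: "continuous_on A (normal_density \<mu> \<sigma>)"
  unfolding normal_density_def by (cases "\<sigma> = 0") (auto intro!: continuous_intros)

lemma DERIV_cdf_std_normal_distribution:
  "(cdf std_normal_distribution has_real_derivative std_normal_density x) (at x)"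
proof -
  have "((\<lambda>y. integral {x - 1..y} std_normal_density)
      has_real_derivative std_normal_density x) (at x within {x - 1..x + 1})"
    by (intro integral_has_real_derivative continuous_on_normal_density) auto
  from DERIV_add[OF DERIV_const[of "cdf std_normal_distribution (x - 1)"] this] have "((\<lambda>y. cdf std_normal_distribution (x - 1) + integral {x - 1..y} std_normal_density)
      has_real_derivative std_normal_density x) (at x)"
    by (subst (asm) at_within_Icc_at) simp_all
  then show ?thesis
  proof (rule has_field_derivative_transform_within_open)
    show "open {x - 1<..<x + 1}" "x \<in> {x - 1<..<x + 1}"
      by auto
    show "cdf std_normal_distribution (x - 1) + integral {x - 1..y} std_normal_density =
        cdf std_normal_distribution y" if "y \<in> {x - 1<..<x + 1}" for y
      using cdf_std_normal_distribution_diff[of "x - 1" y] that by simp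
  qed
qed

text \<open>A positive derivative gives strict increase; comparison with x - 1 and x + 1 then keeps
  the value off 0 and 1.\<close>

lemma cdf_std_normal_distribution_in_01: "cdf std_normal_distribution x \<in> {0<..<1}"
proof -
  interpret N: real_distribution std_normal_distribution
    by (rule real_dist_normal_dist)
  have less: "cdf std_normal_distribution a < cdf std_normal_distribution b" if "a < b" for a b
    by (rule DERIV_pos_imp_increasing[OF that])
      (use DERIV_cdf_std_normal_distribution in \<open>force intro: normal_density_pos\<close>)
  show ?thesis
    using less[of "x - 1" x] less[of x "x + 1"] N.cdf_bounded_prob[of "x + 1"]
      finite_borel_measure.cdf_nonneg[OF N.finite_borel_measure_M, of "x - 1"] by auto
qed

lemma borel_measurable_cdf_std_normal_distribution [measurable]:
  "cdf std_normal_distribution \<in> borel_measurable borel"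
  by (intro borel_measurable_continuous_onI continuous_at_imp_continuous_on ballI
          DERIV_isCont[OF DERIV_cdf_std_normal_distribution])

text \<open>The substitution rule gives the preimage of a null set zero mass under the normal
  density; as this density is positive everywhere, the preimage is Lebesgue-null. Exhausting the
  line by the intervals [-n, n] keeps the substitution on compact sets.\<close>

lemma AE_cdf_std_normal_distribution:
  assumes "AE x in lborel. Q x"
  shows "AE y in lborel. Q (cdf std_normal_distribution y)"
proof -
  let ?\<Phi> = "cdf std_normal_distribution"
  obtain N where N: "{x. \<not> Q x} \<subseteq> N" "emeasure lborel N = 0" "N \<in> sets borel"
    using assms by (auto elim: AE_E)
  have "AE y in lborel. y \<in> {- real n..real n} \<longrightarrow> ?\<Phi> y \<notin> N" for n
  proof (cases "n = 0")
    case False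
    have [measurable]: "N \<in> sets borel" by fact
    have "(\<integral>\<^sup>+y. (indicator N (?\<Phi> y) :: ennreal) * std_normal_density y * indicator {- real n..real n} y \<partial>lborel) =
        (\<integral>\<^sup>+x. indicator N x * indicator {?\<Phi> (- real n)..?\<Phi> (real n)} x \<partial>lborel)"
      using False
      by (intro nn_integral_substitution_aux[symmetric] continuous_on_normal_density
            DERIV_cdf_std_normal_distribution) auto
    also have "\<dots> \<le> (\<integral>\<^sup>+x. indicator N x \<partial>lborel)"
      by (intro nn_integral_mono) (auto split: split_indicator)
    also have "\<dots> = 0"
      using N by simp
    finally have "AE y in lborel. (indicator N (?\<Phi> y) :: ennreal) * std_normal_density y * indicator {- real n..real n} y = 0"
      by (subst (asm) le_zero_eq, subst (asm) nn_integral_0_iff_AE) auto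
    then show ?thesis
    proof eventually_elim
      case (elim y)
      moreover have "ennreal (std_normal_density y) \<noteq> 0"
        using normal_density_pos[of 1 0 y] by simp
      ultimately show ?case
        by (auto simp: indicator_eq_0_iff)
    qed
  next
    \<comment> \<open>Here the interval degenerates to the single point 0, itself a null
      set.\<close>
    case True
    show ?thesis
      using AE_lborel_singleton[of 0] by eventually_elim (simp add: True)
  qed
  then have "AE y in lborel. \<forall>n. y \<in> {- real n..real n} \<longrightarrow> ?\<Phi> y \<notin> N"
    unfolding AE_all_countable ..
  then show ?thesis
  proof eventually_elim
    case (elim y)
    obtain n where "\<bar>y\<bar> \<le> real n"
      using real_arch_simple by blast
    with elim have "?\<Phi> y \<notin> N"
      by (auto simp: abs_le_iff)
    with N(1) show ?case by blast
  qed
qed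

theorem theorem1:
  fixes \<Phi> \<phi> P p s :: "real \<Rightarrow> real" and S :: "real measure"
  assumes "\<phi> = std_normal_density"
    and "\<Phi> = cdf std_normal_distribution"
    and "distribution_function_with_density_on {0<..<1} P p"
    and "\<exists>M>0. AE x in lborel. x \<in> {0<..<1} \<longrightarrow> p x \<le> M"
    and "s = (\<lambda>y. \<phi> y * p (\<Phi> y))"
    and "S = density lborel (\<lambda>y. ennreal (s y))"
    and "\<not> normal_distribution S"
  shows "\<not> infinitely_divisible S"
proof
  assume S: "infinitely_divisible S"
  have p_meas: "p \<in> borel_measurable (restrict_space borel {0<..<1})"
    and p_nonneg: "\<And>x. x \<in> {0<..<1} \<Longrightarrow> 0 \<le> p x"
    using assms(3) by (auto simp: distribution_function_with_density_on_def)
  obtain M where M: "M > 0" "AE x in lborel. x \<in> {0<..<1} \<longrightarrow> p x \<le> M"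
    using assms(4) by blast
  have \<Phi>_01: "\<Phi> y \<in> {0<..<1}" for y
    unfolding assms(2) by (rule cdf_std_normal_distribution_in_01)
  have "\<Phi> \<in> borel_measurable borel"
    by (simp add: assms(2))
  \<comment> \<open>Measurability of p is known only on (0,1), so \<Phi> must be viewed as a map
    into that subspace before composing.\<close>
  then have "\<Phi> \<in> borel \<rightarrow>\<^sub>M restrict_space borel {0<..<1}"
    using \<Phi>_01 by (intro measurable_restrict_space2) auto
  from measurable_compose[OF this p_meas] have [measurable]: "s \<in> borel_measurable borel"
    unfolding assms(1,5) by measurable
  have s_nonneg: "0 \<le> s y" for y
    using p_nonneg[OF \<Phi>_01] by (simp add: assms(1,5))
  have "AE y in lborel. \<Phi> y \<in> {0<..<1} \<longrightarrow> p (\<Phi> y) \<le> M"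
    unfolding assms(2) by (rule AE_cdf_std_normal_distribution[OF M(2)])
  then have s_le: "AE y in lborel. s y \<le> M * std_normal_density y"
  proof eventually_elim
    case (elim y)
    then have "std_normal_density y * p (\<Phi> y) \<le> std_normal_density y * M"
      using \<Phi>_01 by (intro mult_left_mono) auto
    then show ?case
      by (simp add: assms(1,5) mult.commute)
  qed
  have nn_bound: "(\<integral>\<^sup>+x. ennreal (exp (t * x)) \<partial>S) \<le> ennreal (M * exp (t\<^sup>2 / 2))" for t
  proof -
    have "(\<integral>\<^sup>+x. ennreal (exp (t * x)) \<partial>S) = (\<integral>\<^sup>+y. ennreal (s y * exp (t * y)) \<partial>lborel)"
      by (simp add: assms(6) nn_integral_density ennreal_mult s_nonneg)
    also have "\<dots> \<le> (\<integral>\<^sup>+y. ennreal M * ennreal (std_normal_density y * exp (t * y)) \<partial>lborel)"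
      by (intro nn_integral_mono_AE, use s_le in eventually_elim)
        (use M(1) in \<open>simp add: ennreal_leI mult.assoc[symmetric] flip: ennreal_mult\<close>)
    also have "\<dots> = ennreal (M * exp (t\<^sup>2 / 2))"
      using M(1) by (simp add: nn_integral_cmult nn_integral_std_normal_exp ennreal_mult[of M])
    finally show ?thesis .
  qed
  have [measurable_cong]: "sets S = sets borel"
    by (simp add: assms(6))
  have integrable_exp: "integrable S (\<lambda>x. exp (t * x))" for t
    using nn_bound[of t] by (intro integrableI_bounded) (auto simp: le_less_trans)
  \<comment> \<open>The exponent is written to match the general bound with C = M and B =
    1/2.\<close>
  have "(\<integral>x. exp (t * x) \<partial>S) \<le> M * exp (1 / 2 * t\<^sup>2)" for t
    using nn_bound[of t] M(1)
    by (subst (asm) nn_integral_eq_integral[OF integrable_exp]) (auto simp: ennreal_le_iff)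
  from infinitely_divisible_gaussian_bound_normal[OF S integrable_exp this] assms(7)
  obtain \<mu> where "S = return borel \<mu>"
    by auto
  then have "emeasure S {\<mu>} = 1"
    by simp
  \<comment> \<open>A law with a Lebesgue density has no atoms, which rules out the point
    mass.\<close>
  moreover have "emeasure S {\<mu>} = 0"
    unfolding assms(6)
    by (subst emeasure_density) (auto simp: nn_integral_0_iff_AE intro: AE_mp[OF AE_lborel_singleton[of \<mu>]])
  ultimately show False
    by simp
qed

end
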